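(* Let $q\in(0,1)$ and let $m,n\in\mathbb{N}=\{1,2,\dots\}$ with $m>n$. Let $T$ be the rank one operator on $A^2(\mathbb{D})$ given by $T(f)=\langle f,z^n\rangle z^m$ for $f\in A^2(\mathbb{D})$. Then $\mathbf{Ber}_q(T)$ is a disc centered at the origin.
   Context: $\mathbb{D}$ is the open unit disk; $A^2(\mathbb{D})$ is the Bergman space of holomorphic $f$ on $\mathbb{D}$ with $\int_{\mathbb{D}}|f|^2dA<\infty$, $dA$ being area measure normalized so that $\mathbb{D}$ has area $1$. Its normalized reproducing kernel is $\hat k_\lambda(z)=\frac{1-|\lambda|^2}{(1-\overline\lambda z)^2}$, $\lambda,z\in\mathbb{D}$. For a bounded operator $T$ on $A^2(\mathbb{D})$, $\mathbf{Ber}_q(T)=\{\langle T\hat k_\lambda,\hat k_\mu\rangle:\lambda,\mu\in\mathbb{D},\ \langle\hat k_\lambda,\hat k_\mu\rangle=q\}$. "Disc" means a circular disc in $\mathbb{C}$, open or closed (not specified which). *)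

theory Defs
  imports "HOL-Analysis.Analysis"
begin

(* Elements of the Bergman space are represented by total functions on the complex plane,
   of which only the values on the unit disk matter; all integrals are therefore
   set integrals over the disk. *)

definition bergman_space :: "(complex \<Rightarrow> complex) set" where
  "bergman_space = {f. f holomorphic_on ball 0 1 \<and>
     set_integrable lborel (ball 0 1) (\<lambda>z. (cmod (f z))\<^sup>2)}"

(* Division by pi normalizes area measure so that the unit disk has area 1. *)

definition bergman_inner :: "(complex \<Rightarrow> complex) \<Rightarrow> (complex \<Rightarrow> complex) \<Rightarrow> complex" where
  "bergman_inner f g = (LINT z:ball 0 1|lborel. f z * cnj (g z)) / of_real pi"

definition bergman_normalized_kernel :: "complex \<Rightarrow> complex \<Rightarrow> complex" where
  "bergman_normalized_kernel l z = of_real (1 - (cmod l)\<^sup>2) / (1 - cnj l * z)\<^sup>2"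

definition q_berezin_range ::
    "complex \<Rightarrow> ((complex \<Rightarrow> complex) \<Rightarrow> complex \<Rightarrow> complex) \<Rightarrow> complex set" where
  "q_berezin_range q T =
     {bergman_inner (T (bergman_normalized_kernel l)) (bergman_normalized_kernel u) | l u.
        l \<in> ball 0 1 \<and> u \<in> ball 0 1 \<and>
        bergman_inner (bergman_normalized_kernel l) (bergman_normalized_kernel u) = q}"

end

theory Submission
  imports Defs "HOL-Probability.Distribution_Functions"
begin

text \<open>
  Expanding the kernels in monomials, which are orthogonal with squared norm \<open>1 / (k + 1)\<close>, turns
  the range into the set of all \<open>(1 - |l|^2) (1 - |u|^2) cnj l ^ n u ^ m\<close> with
  \<open>(1 - |l|^2) (1 - |u|^2) = q (1 - cnj l u)^2\<close>. Since \<open>1 - cnj l u\<close> has positive real part, the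
  constraint forces \<open>cnj l u\<close> to be real, so \<open>l = s e\<close> and \<open>u = t e\<close> with \<open>|e| = 1\<close> and \<open>s, t\<close> real at
  pseudohyperbolic distance \<open>sqrt (1 - q)\<close>. As \<open>e\<close> varies, the factor \<open>e ^ (m - n)\<close> sweeps the unit
  circle, so the range is rotation invariant. The moduli are the values of a continuous function
  of \<open>s\<close> on the interval from \<open>-1\<close> to \<open>1\<close> that vanishes at \<open>0\<close> and at the end points; hence they
  fill an interval from \<open>0\<close> to an attained maximum, and the disc is closed.
\<close>

section \<open>Rotation invariance of area measure\<close>

text \<open>By Fubini, with the first coordinate integrated first: for a fixed second coordinate the
  shear is a translation of the line.\<close>

lemma distr_lborel_shear_fst:
  "distr lborel borel (\<lambda>p. (fst p + a * snd p, snd p)) = (lborel :: (real \<times> real) measure)"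
  (is "distr _ _ ?f = _")
proof (rule measure_eqI)
  have mf: "?f \<in> borel \<rightarrow>\<^sub>M borel"
    by (intro borel_measurable_continuous_onI continuous_intros)
  fix A :: "(real \<times> real) set" assume "A \<in> sets (distr lborel borel ?f)"
  then have A: "A \<in> sets borel" by simp
  have mi: "(\<lambda>p. indicator A p :: ennreal) \<in> borel_measurable borel" using A by measurable
  have mi2: "(\<lambda>p. indicator A (?f p) :: ennreal) \<in> borel_measurable borel"
    by (rule measurable_compose[OF mf mi])
  have b: "(borel :: (real \<times> real) measure) = borel \<Otimes>\<^sub>M borel" by (simp add: borel_prod)
  have "emeasure (distr lborel borel ?f) A = (\<integral>\<^sup>+p. indicator A p \<partial>distr lborel borel ?f)"
    using A by simp
  also have "\<dots> = (\<integral>\<^sup>+p. indicator A (?f p) \<partial>lborel)"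
    using mi mf by (subst nn_integral_distr) auto
  also have "\<dots> = (\<integral>\<^sup>+y. \<integral>\<^sup>+x. indicator A (?f (x, y)) \<partial>lborel \<partial>lborel)"
    using mi2 by (subst lborel_prod[symmetric], subst lborel_pair.nn_integral_snd[symmetric])
      (auto simp: b)
  also have "\<dots> = (\<integral>\<^sup>+y. \<integral>\<^sup>+x. indicator A (x, y) \<partial>lborel \<partial>lborel)"
  proof (rule nn_integral_cong)
    fix y :: real
    have "(\<lambda>x. indicator A (x, y) :: ennreal) \<in> borel_measurable borel"
      using measurable_compose[OF _ mi, of "\<lambda>x. (x, y)" borel] by simp
    from nn_integral_real_affine[OF this, of 1 "a * y"]
    show "(\<integral>\<^sup>+x. indicator A (?f (x, y)) \<partial>lborel) = (\<integral>\<^sup>+x. indicator A (x, y) \<partial>lborel)"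
      by (simp add: add.commute)
  qed
  also have "\<dots> = (\<integral>\<^sup>+p. indicator A p \<partial>lborel)"
    using lborel_pair.nn_integral_snd[of "indicator A"] mi by (simp add: lborel_prod)
  also have "\<dots> = emeasure lborel A" using A by simp
  finally show "emeasure (distr lborel borel ?f) A = emeasure lborel A" .
qed simp

text \<open>This is the other shear conjugated by the coordinate swap, which preserves product
  measure.\<close>

lemma distr_lborel_shear_snd:
  "distr lborel borel (\<lambda>p. (fst p, snd p + a * fst p)) = (lborel :: (real \<times> real) measure)"
proof -
  let ?swap = "\<lambda>p :: real \<times> real. (snd p, fst p)"
  let ?f = "\<lambda>p :: real \<times> real. (fst p + a * snd p, snd p)"
  have "distr lborel borel ?swap = distr lborel lborel ?swap"
    by (rule distr_cong) simp_all
  also have "\<dots> = lborel"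
    using lborel_pair.distr_pair_swap[symmetric] by (simp only: lborel_prod case_prod_unfold)
  finally have swap: "distr lborel borel ?swap = (lborel :: (real \<times> real) measure)" .
  have [measurable]: "?swap \<in> borel \<rightarrow>\<^sub>M borel" "?f \<in> borel \<rightarrow>\<^sub>M borel"
    by (intro borel_measurable_continuous_onI continuous_intros)+
  have "distr lborel borel (\<lambda>p. (fst p, snd p + a * fst p))
      = distr lborel borel (?swap \<circ> (?f \<circ> ?swap))"
    by (simp add: o_def)
  also have "\<dots> = distr (distr (distr lborel borel ?swap) borel ?f) borel ?swap"
    by (simp add: distr_distr o_assoc)
  finally show ?thesis by (simp add: swap distr_lborel_shear_fst)
qed

lemma distr_lborel_rotation:
  assumes "c\<^sup>2 + s\<^sup>2 = 1" "s \<noteq> 0"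
  shows "distr lborel borel (\<lambda>p. (c * fst p - s * snd p, s * fst p + c * snd p))
       = (lborel :: (real \<times> real) measure)"
proof -
  \<comment> \<open>a plane rotation is a product of three shears\<close>
  define a where "a = (c - 1) / s"
  define X where "X = (\<lambda>p :: real \<times> real. (fst p + a * snd p, snd p))"
  define Y where "Y = (\<lambda>p :: real \<times> real. (fst p, snd p + s * fst p))"
  have [measurable]: "X \<in> borel \<rightarrow>\<^sub>M borel" "Y \<in> borel \<rightarrow>\<^sub>M borel"
    unfolding X_def Y_def by (intro borel_measurable_continuous_onI continuous_intros)+
  have as: "a * s = c - 1" using assms by (simp add: a_def)
  \<comment> \<open>If \<open>c\<close> and \<open>s\<close> are the cosine and sine of an angle,
    \<open>a\<close> is minus the tangent of half of it. The identity is
    \<open>(c - 1) * (c + 1) = - s^2\<close> divided by \<open>s\<close>.\<close>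
  have aa: "a * (1 + c) = - s"
    using assms by (simp add: a_def field_simps power2_eq_square)
  have "(\<lambda>p. (c * fst p - s * snd p, s * fst p + c * snd p)) = X \<circ> (Y \<circ> X)"
  proof
    fix p :: "real \<times> real"
    obtain x y where p: "p = (x, y)" by (cases p)
    have 1: "y + s * (x + a * y) = s * x + c * y"
      using as by (simp add: algebra_simps) (metis (no_types) add.commute diff_add_cancel
          distrib_right mult.assoc mult.commute mult_1)
    have "x + a * y + a * (s * x + c * y) = x + (a * s) * x + (a * (1 + c)) * y"
      by (simp add: algebra_simps)
    also have "\<dots> = c * x - s * y"
      unfolding as aa by (simp add: algebra_simps)
    finally have 2: "x + a * y + a * (y + s * (x + a * y)) = c * x - s * y" by (simp add: 1)
    show "(c * fst p - s * snd p, s * fst p + c * snd p) = (X \<circ> (Y \<circ> X)) p"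
      using 1 2 by (simp add: p X_def Y_def)
  qed
  moreover have "distr lborel borel (X \<circ> (Y \<circ> X))
      = distr (distr (distr lborel borel X) borel Y) borel X"
    by (simp add: distr_distr o_assoc)
  ultimately show ?thesis
    using distr_lborel_shear_fst[of a] distr_lborel_shear_snd[of s] by (simp add: X_def Y_def)
qed

text \<open>Lebesgue measure is determined by its values on boxes, and a box in the complex plane
  pulls back to a product of two intervals. This carries facts about pairs of reals over to complex
  numbers.\<close>

lemma lborel_complex_eq:
  "(lborel :: complex measure) = distr lborel borel (\<lambda>p. Complex (fst p) (snd p))"
proof (rule lborel_eqI)
  have [measurable]: "(\<lambda>p. Complex (fst p) (snd p)) \<in> borel \<rightarrow>\<^sub>M borel"
    by (intro borel_measurable_continuous_onI continuous_on_Complex continuous_intros)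
  fix l u :: complex
  assume le: "\<And>b. b \<in> Basis \<Longrightarrow> l \<bullet> b \<le> u \<bullet> b"
  have le': "Re l \<le> Re u" "Im l \<le> Im u"
    using le[of 1] le[of \<i>] by (auto simp: Basis_complex_def)
  have eq: "(\<lambda>p. Complex (fst p) (snd p)) -` box l u = box (Re l) (Re u) \<times> box (Im l) (Im u)"
    by (auto simp: box_def Basis_complex_def)
  have "emeasure (distr lborel borel (\<lambda>p. Complex (fst p) (snd p))) (box l u)
      = emeasure (lborel \<Otimes>\<^sub>M lborel) (box (Re l) (Re u) \<times> box (Im l) (Im u))"
    by (subst emeasure_distr) (auto simp: eq lborel_prod)
  also have "\<dots> = ennreal ((Re u - Re l) * (Im u - Im l))"
    using le' by (subst lborel.emeasure_pair_measure_Times) (auto simp: ennreal_mult)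
  also have "(Re u - Re l) * (Im u - Im l) = (\<Prod>b\<in>Basis. (u - l) \<bullet> b)"
    by (simp add: Basis_complex_def)
  finally show "emeasure (distr lborel borel (\<lambda>p. Complex (fst p) (snd p))) (box l u)
      = (\<Prod>b\<in>Basis. (u - l) \<bullet> b)" .
qed simp

text \<open>In real coordinates, multiplication by \<open>w\<close> is the rotation with cosine
  \<open>Re w\<close> and sine \<open>Im w\<close>. The condition on \<open>Im w\<close> comes from
  the division by the sine in the shear decomposition.\<close>

lemma distr_lborel_complex_rotation:
  assumes "cmod w = 1" "Im w \<noteq> 0"
  shows "distr lborel borel (\<lambda>z. w * z) = lborel"
proof -
  let ?C = "\<lambda>p. Complex (fst p) (snd p)"
  let ?R = "\<lambda>p. (Re w * fst p - Im w * snd p, Im w * fst p + Re w * snd p)"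
  have [measurable]: "?C \<in> borel \<rightarrow>\<^sub>M borel"
    by (intro borel_measurable_continuous_onI continuous_on_Complex continuous_intros)
  have [measurable]: "?R \<in> borel \<rightarrow>\<^sub>M borel"
    by (intro borel_measurable_continuous_onI continuous_intros)
  have [measurable]: "(\<lambda>z. w * z) \<in> borel \<rightarrow>\<^sub>M borel" by measurable
  have *: "(\<lambda>z. w * z) \<circ> ?C = ?C \<circ> ?R"
    by (auto simp: fun_eq_iff complex_eq_iff)
  have "(Re w)\<^sup>2 + (Im w)\<^sup>2 = 1" using assms(1) by (simp add: cmod_def)
  then have R: "distr lborel borel ?R = lborel" using assms(2) by (rule distr_lborel_rotation)
  have "distr lborel borel (\<lambda>z. w * z) = distr (distr lborel borel ?C) borel (\<lambda>z. w * z)"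
    by (simp flip: lborel_complex_eq)
  also have "\<dots> = distr lborel borel (?C \<circ> ?R)"
    by (subst distr_distr) (simp_all add: *)
  also have "\<dots> = distr (distr lborel borel ?R) borel ?C"
    by (subst distr_distr) simp_all
  finally show ?thesis by (simp add: R flip: lborel_complex_eq)
qed

section \<open>Orthogonality of the monomials\<close>

lemma bergman_inner_monomials_neq:
  assumes "j \<noteq> k"
  shows "bergman_inner (\<lambda>z. z ^ j) (\<lambda>z. z ^ k) = 0"
proof -
  define d where "d = (if j < k then k - j else j - k)"
  have d: "d > 0" using assms by (auto simp: d_def)
  \<comment> \<open>The rotation by \<open>w\<close> multiplies the integral by \<open>w ^ d = \<i>\<close> or its conjugate. The factor 2 keeps
    \<open>w\<close> off the real axis, as the decomposition into shears requires.\<close>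
  define w where "w = cis (pi / (2 * real d))"
  have w1: "cmod w = 1" by (simp add: w_def)
  have "Im w > 0" using d by (simp add: w_def) (rule sin_gt_zero, auto simp: field_simps)
  then have rot: "distr lborel borel (\<lambda>z. w * z) = lborel"
    by (intro distr_lborel_complex_rotation w1) auto
  have "w ^ d = cis (real d * (pi / (2 * real d)))" unfolding w_def by (rule Complex.DeMoivre)
  also have "real d * (pi / (2 * real d)) = pi / 2" using d by simp
  finally have wd: "w ^ d = \<i>" by simp
  have ww: "w * cnj w = 1" using w1 complex_norm_square[of w] by simp
  have ne: "w ^ j * cnj w ^ k \<noteq> 1"
  proof (cases "j < k")
    case True
    then have k: "k = j + d" by (simp add: d_def)
    have "w ^ j * cnj w ^ k = (w * cnj w) ^ j * cnj (w ^ d)"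
      by (simp add: k power_add power_mult_distrib)
    then show ?thesis by (simp add: ww wd complex_eq_iff)
  next
    case False
    then have k: "j = k + d" using assms by (simp add: d_def)
    have "w ^ j * cnj w ^ k = (w * cnj w) ^ k * w ^ d"
      by (simp add: k power_add power_mult_distrib)
    then show ?thesis by (simp add: ww wd complex_eq_iff)
  qed
  define h where "h = (\<lambda>z::complex. indicator (ball 0 1) z *\<^sub>R (z ^ j * cnj (z ^ k)))"
  have h: "h \<in> borel_measurable borel"
    unfolding h_def by (intro borel_measurable_continuous_on_indicator continuous_intros) auto
  have hw: "h (w * z) = w ^ j * cnj w ^ k * h z" for z
    by (auto simp: h_def indicator_def w1 norm_mult power_mult_distrib)
  have "integral\<^sup>L lborel h = integral\<^sup>L (distr lborel borel (\<lambda>z. w * z)) h" by (simp add: rot)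
  also have "\<dots> = (LINT z|lborel. h (w * z))"
    using h by (intro integral_distr) auto
  also have "\<dots> = w ^ j * cnj w ^ k * integral\<^sup>L lborel h" by (simp add: hw)
  finally have "integral\<^sup>L lborel h = 0" using ne by auto
  then show ?thesis by (simp add: bergman_inner_def set_lebesgue_integral_def h_def)
qed

section \<open>Radial integrals and the norms of the monomials\<close>

lemma emeasure_disk: "r \<ge> 0 \<Longrightarrow> emeasure lborel (ball (0::complex) r) = ennreal (pi * r\<^sup>2)"
  using emeasure_ball[of r "0::complex"] by (simp add: eval_unit_ball_vol)

lemma emeasure_closed_disk: "r \<ge> 0 \<Longrightarrow> emeasure lborel (cball (0::complex) r) = ennreal (pi * r\<^sup>2)"
  using emeasure_cball[of r "0::complex"] by (simp add: eval_unit_ball_vol)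

text \<open>Stands in for polar coordinates: the disk of radius \<open>sqrt x\<close> has normalized
  area \<open>x\<close>, so both measures have the same distribution function.\<close>

lemma uniform_measure_disk_norm_square:
  "distr (uniform_measure lborel (ball (0::complex) 1)) borel (\<lambda>z. (cmod z)\<^sup>2)
     = uniform_measure lborel {0..1::real}" (is "distr ?U borel ?f = ?V")
proof (rule cdf_unique)
  interpret U: prob_space ?U
    by (rule prob_space_uniform_measure) (simp_all add: emeasure_disk)
  interpret V: prob_space ?V
    by (rule prob_space_uniform_measure) simp_all
  have f [measurable]: "?f \<in> borel_measurable borel" by measurable
  have "prob_space (distr ?U borel ?f)" by (rule U.prob_space_distr) simp
  then show "real_distribution (distr ?U borel ?f)"
    by (auto simp: real_distribution_def real_distribution_axioms_def)
  show "real_distribution ?V"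
    by (auto simp: real_distribution_def real_distribution_axioms_def V.prob_space_axioms)
  show "cdf (distr ?U borel ?f) = cdf ?V"
  proof
    fix x :: real
    have "cdf (distr ?U borel ?f) x = measure ?U (?f -` {..x})"
      by (simp add: cdf_def measure_distr)
    also have "\<dots> = measure lborel (ball 0 1 \<inter> ?f -` {..x}) / pi"
      using measurable_sets_borel[OF f, of "{..x}"]
      by (subst measure_uniform_measure) (simp_all add: emeasure_disk measure_def)
    also have "\<dots> = measure lborel ({0..1} \<inter> {..x})"
    proof -
      consider "x < 0" | "0 \<le> x" "x < 1" | "1 \<le> x" by linarith
      then show ?thesis
      proof cases
        case 1
        then have "?f -` {..x} = {}" by (auto dest: order_trans[OF zero_le_power2])
        with 1 show ?thesis by simp
      next
        case 2
        have "cmod z \<le> sqrt x \<Longrightarrow> cmod z < 1" for z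
          using 2 le_less_trans[of "cmod z" "sqrt x" 1] by simp
        moreover have "(cmod z)\<^sup>2 \<le> x \<longleftrightarrow> cmod z \<le> sqrt x" for z
          using real_sqrt_le_iff[of "(cmod z)\<^sup>2" x] by simp
        ultimately have "ball 0 1 \<inter> ?f -` {..x} = cball 0 (sqrt x)" by auto
        moreover have "{0..1} \<inter> {..x} = {0..x}" using 2 by auto
        ultimately show ?thesis using 2 by (simp add: measure_def emeasure_closed_disk)
      next
        case 3
        have "cmod z < 1 \<Longrightarrow> (cmod z)\<^sup>2 \<le> x" for z
          using 3 power_le_one[of "cmod z" 2] by simp
        then have "ball 0 1 \<inter> ?f -` {..x} = ball 0 1" by auto
        moreover have "{0..1} \<inter> {..x} = {0..1}" using 3 by auto
        ultimately show ?thesis by (simp add: measure_def emeasure_disk)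
      qed
    qed
    also have "\<dots> = cdf ?V x"
      by (simp add: cdf_def measure_uniform_measure)
    finally show "cdf (distr ?U borel ?f) x = cdf ?V x" .
  qed
qed

lemma integral_uniform_measure:
  fixes f :: "'a \<Rightarrow> real"
  assumes "A \<in> sets M" "f \<in> borel_measurable M" "emeasure M A = ennreal c" "c > 0"
  shows "(\<integral>x. f x \<partial>uniform_measure M A) = (LINT x:A|M. f x) / c"
proof -
  have "uniform_measure M A = density M (\<lambda>x. ennreal (indicator A x / c))"
    using assms by (auto simp: uniform_measure_def indicator_def divide_ennreal
        simp flip: ennreal_1 intro!: density_cong)
  then have "(\<integral>x. f x \<partial>uniform_measure M A) = (\<integral>x. (indicator A x / c) *\<^sub>R f x \<partial>M)"
    using assms by (simp add: integral_density)
  then show ?thesis by (simp add: set_lebesgue_integral_def)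
qed

text \<open>The integrand is the \<open>k\<close>-th power of the squared modulus, which is
  uniformly distributed on the unit interval, so the integral becomes that of \<open>x ^ k\<close>
  over \<open>{0..1}\<close>.\<close>

lemma bergman_inner_monomials_eq:
  "bergman_inner (\<lambda>z. z ^ k) (\<lambda>z. z ^ k) = 1 / of_nat (Suc k)"
proof -
  let ?D = "ball (0::complex) 1"
  have "z ^ k * cnj (z ^ k) = complex_of_real (((cmod z)\<^sup>2) ^ k)" for z
    unfolding of_real_power[of "(cmod z)\<^sup>2" k] complex_norm_square
    by (simp add: power_mult_distrib)
  then have "(LINT z:?D|lborel. z ^ k * cnj (z ^ k)) = (LINT z:?D|lborel. complex_of_real (((cmod z)\<^sup>2) ^ k))"
    by simp
  also have "\<dots> = of_real (LINT z:?D|lborel. ((cmod z)\<^sup>2) ^ k)"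
    by (rule set_integral_complex_of_real)
  also have "(LINT z:?D|lborel. ((cmod z)\<^sup>2) ^ k)
      = pi * (\<integral>z. ((cmod z)\<^sup>2) ^ k \<partial>uniform_measure lborel ?D)"
    by (subst integral_uniform_measure[where c = pi]) (simp_all add: emeasure_disk)
  also have "(\<integral>z. ((cmod z)\<^sup>2) ^ k \<partial>uniform_measure lborel ?D)
      = (\<integral>x. x ^ k \<partial>uniform_measure lborel {0..1})"
    by (simp add: integral_distr flip: uniform_measure_disk_norm_square)
  also have "\<dots> = (LINT x:{0..1}|lborel. x ^ k)"
    by (subst integral_uniform_measure[where c = 1]) simp_all
  also have "\<dots> = 1 / Suc k"
    by (simp add: set_lebesgue_integral_def mult.commute integral_power)
  finally show ?thesis by (simp add: bergman_inner_def)
qed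

lemma bergman_inner_monomials:
  "bergman_inner (\<lambda>z. z ^ j) (\<lambda>z. z ^ k) = (if j = k then 1 / of_nat (Suc k) else 0)"
  using bergman_inner_monomials_eq bergman_inner_monomials_neq by auto

section \<open>Termwise evaluation of inner products\<close>

lemma bergman_inner_cong:
  assumes "\<And>z. cmod z < 1 \<Longrightarrow> f z = f' z" "\<And>z. cmod z < 1 \<Longrightarrow> g z = g' z"
  shows "bergman_inner f g = bergman_inner f' g'"
  unfolding bergman_inner_def
  by (intro arg_cong2[where f = "(/)"] set_lebesgue_integral_cong refl) (auto simp: assms)

lemma bergman_inner_mult_left: "bergman_inner (\<lambda>z. c * f z) g = c * bergman_inner f g"
  by (simp add: bergman_inner_def mult.assoc)

lemma bergman_inner_commute: "bergman_inner g f = cnj (bergman_inner f g)"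
proof -
  have "cnj (LINT z:ball 0 1|lborel. f z * cnj (g z)) = (LINT z:ball 0 1|lborel. g z * cnj (f z))"
    unfolding set_lebesgue_integral_def
    by (subst Bochner_Integration.integral_cnj[symmetric]) (simp add: mult.commute)
  then show ?thesis by (simp add: bergman_inner_def)
qed

lemma set_integrable_disk:
  fixes h :: "complex \<Rightarrow> 'a :: {banach, second_countable_topology}"
  assumes "continuous_on (ball 0 1) h" "\<And>z. cmod z < 1 \<Longrightarrow> norm (h z) \<le> B"
  shows "set_integrable lborel (ball 0 1) h"
  unfolding set_integrable_def
proof (rule Bochner_Integration.integrable_bound)
  show "integrable lborel (\<lambda>z::complex. indicator (ball 0 1) z *\<^sub>R B)"
    by (intro integrable_scaleR_left integrable_real_indicator) (auto simp: emeasure_disk)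
  show "(\<lambda>z. indicator (ball 0 1) z *\<^sub>R h z) \<in> borel_measurable lborel"
    using assms(1) by (simp add: borel_measurable_continuous_on_indicator)
  show "AE z::complex in lborel. norm (indicator (ball 0 1) z *\<^sub>R h z) \<le> norm (indicator (ball 0 1) z *\<^sub>R B)"
    using assms(2) by (intro AE_I2) (fastforce simp: indicator_def intro: order_trans[OF _ abs_ge_self])
qed

text \<open>Sum and integral may be exchanged because on the disk the \<open>j\<close>-th term is at
  most \<open>norm (a j) * B\<close>, which is summable, and the disk has finite area.\<close>

lemma bergman_inner_power_series:
  assumes a: "summable (\<lambda>j. norm (a j))"
    and f: "\<And>z. cmod z < 1 \<Longrightarrow> (\<lambda>j. a j * z ^ j) sums f z"
    and g: "continuous_on (ball 0 1) g" "\<And>z. cmod z < 1 \<Longrightarrow> cmod (g z) \<le> B"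
  shows "(\<lambda>j. a j * bergman_inner (\<lambda>z. z ^ j) g) sums bergman_inner f g"
proof -
  let ?D = "ball (0::complex) 1"
  define h where "h j z = indicator ?D z *\<^sub>R (a j * z ^ j * cnj (g z))" for j z
  have B: "B \<ge> 0" using order_trans[OF norm_ge_zero g(2)[of 0]] by simp
  have hb: "norm (a j * z ^ j * cnj (g z)) \<le> norm (a j) * B" if "cmod z < 1" for j z
  proof -
    have "cmod z ^ j \<le> 1" using that by (intro power_le_one) auto
    then have "(norm (a j) * cmod z ^ j) * cmod (g z) \<le> (norm (a j) * 1) * B"
      by (intro mult_mono g(2) that mult_nonneg_nonneg) auto
    then show ?thesis by (simp add: norm_mult norm_power)
  qed
  have int: "integrable lborel (h j)" for j
  proof -
    have "continuous_on ?D (\<lambda>z. a j * z ^ j * cnj (g z))"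
      by (intro continuous_intros g(1))
    then have "set_integrable lborel ?D (\<lambda>z. a j * z ^ j * cnj (g z))"
      using hb by (rule set_integrable_disk)
    then show ?thesis by (simp only: h_def [abs_def] set_integrable_def)
  qed
  have nh: "norm (h j z) \<le> norm (a j) * (B * indicator ?D z)" for j z
    using hb[of z j] by (auto simp: h_def indicator_def)
  have si: "integrable lborel (\<lambda>z. norm (a j) * (B * indicator ?D z))" for j
    by (intro integrable_mult_right integrable_real_indicator) (auto simp: emeasure_disk)
  have "(\<lambda>j. integral\<^sup>L lborel (h j)) sums (\<integral>z. (\<Sum>j. h j z) \<partial>lborel)"
  proof (rule sums_integral)
    show "AE z in lborel. summable (\<lambda>j. norm (h j z))"
      using nh by (intro AE_I2 summable_comparison_test'[OF summable_mult2[OF a]]) auto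
    have "(\<integral>z. norm (h j z) \<partial>lborel) \<le> norm (a j) * (B * pi)" for j
    proof -
      have "(\<integral>z. norm (h j z) \<partial>lborel) \<le> (\<integral>z. norm (a j) * (B * indicator ?D z) \<partial>lborel)"
        using int si nh by (intro integral_mono) auto
      also have "\<dots> = norm (a j) * (B * pi)"
        by (simp add: measure_def emeasure_disk)
      finally show ?thesis .
    qed
    then show "summable (\<lambda>j. \<integral>z. norm (h j z) \<partial>lborel)"
      by (intro summable_comparison_test'[OF summable_mult2[OF a]]) auto
  qed (rule int)
  \<comment> \<open>Since \<open>bergman_inner\<close> divides by \<open>pi\<close>, a factor
    \<open>pi\<close> is pulled out of each term and of the sum, to be cancelled at the end.\<close>
  also have "(\<lambda>j. integral\<^sup>L lborel (h j)) = (\<lambda>j. pi * (a j * bergman_inner (\<lambda>z. z ^ j) g))"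
  proof
    fix j
    have "integral\<^sup>L lborel (h j) = (LINT z:?D|lborel. a j * (z ^ j * cnj (g z)))"
      unfolding h_def [abs_def] set_lebesgue_integral_def mult.assoc ..
    then show "integral\<^sup>L lborel (h j) = pi * (a j * bergman_inner (\<lambda>z. z ^ j) g)"
      by (simp add: bergman_inner_def)
  qed
  also have "(\<integral>z. (\<Sum>j. h j z) \<partial>lborel) = pi * bergman_inner f g"
  proof -
    have "(\<Sum>j. h j z) = indicator ?D z *\<^sub>R (f z * cnj (g z))" for z
      using sums_mult2[OF f, of z "cnj (g z)"]
      by (auto simp: h_def indicator_def sums_iff)
    then show ?thesis by (simp add: bergman_inner_def set_lebesgue_integral_def)
  qed
  finally show ?thesis by (simp add: sums_mult_iff)
qed

section \<open>The normalized kernels\<close>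

text \<open>The differentiated geometric series, with sum \<open>1 / (1 - x)^2\<close>, at
  \<open>x = cnj l * z\<close>.\<close>

lemma bergman_normalized_kernel_sums:
  assumes "cmod l < 1" "cmod z < 1"
  shows "(\<lambda>j. of_real (1 - (cmod l)\<^sup>2) * (of_nat (Suc j) * cnj l ^ j) * z ^ j)
           sums bergman_normalized_kernel l z"
proof -
  have "cmod (cnj l * z) < 1"
    using assms mult_strict_mono'[of "cmod l" 1 "cmod z" 1] by (simp add: norm_mult)
  from sums_mult[OF geometric_deriv_sums[OF this], of "of_real (1 - (cmod l)\<^sup>2)"] show ?thesis
    by (simp only: bergman_normalized_kernel_def power_mult_distrib mult.assoc times_divide_eq_right mult_1_right)
qed

lemma one_minus_cnj_mult_nonzero:
  assumes "cmod l < 1" "cmod z < 1"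
  shows "1 - cnj l * z \<noteq> 0"
proof
  assume "1 - cnj l * z = 0"
  then have "cmod l * cmod z = 1" by (metis complex_mod_cnj eq_iff_diff_eq_0 norm_mult norm_one)
  then show False using assms mult_strict_mono'[of "cmod l" 1 "cmod z" 1] by simp
qed

lemma bergman_normalized_kernel_holomorphic:
  "cmod l < 1 \<Longrightarrow> bergman_normalized_kernel l holomorphic_on ball 0 1"
  unfolding bergman_normalized_kernel_def [abs_def]
  using one_minus_cnj_mult_nonzero by (intro holomorphic_intros) auto

text \<open>The denominator stays away from zero: \<open>cmod (1 - cnj l * z)\<close> is at least
  \<open>1 - cmod l\<close>. The bound puts the kernel into the Bergman space and allows it as the
  second factor in termwise integration.\<close>

lemma bergman_normalized_kernel_bounded:
  assumes "cmod l < 1" "cmod z < 1"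
  shows "cmod (bergman_normalized_kernel l z) \<le> (1 - (cmod l)\<^sup>2) / (1 - cmod l)\<^sup>2"
proof -
  have "1 - cmod l \<le> 1 - cmod l * cmod z"
    using assms by (simp add: mult_left_le)
  also have "\<dots> \<le> cmod (1 - cnj l * z)"
    using norm_triangle_ineq2[of 1 "cnj l * z"] by (simp add: norm_mult)
  finally have "(1 - cmod l)\<^sup>2 \<le> (cmod (1 - cnj l * z))\<^sup>2"
    using assms by (intro power_mono) auto
  moreover have "(cmod l)\<^sup>2 \<le> 1" using assms by (intro power_le_one) auto
  ultimately have "(1 - (cmod l)\<^sup>2) / (cmod (1 - cnj l * z))\<^sup>2 \<le> (1 - (cmod l)\<^sup>2) / (1 - cmod l)\<^sup>2"
    using assms by (intro divide_left_mono mult_pos_pos) auto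
  then show ?thesis using \<open>(cmod l)\<^sup>2 \<le> 1\<close>
    by (simp add: bergman_normalized_kernel_def norm_divide norm_power del: of_real_diff)
qed

lemma bergman_normalized_kernel_in_space:
  assumes "cmod l < 1"
  shows "bergman_normalized_kernel l \<in> bergman_space"
proof -
  let ?k = "bergman_normalized_kernel l"
  have "continuous_on (ball 0 1) ?k"
    using bergman_normalized_kernel_holomorphic[OF assms] by (rule holomorphic_on_imp_continuous_on)
  then have "set_integrable lborel (ball 0 1) (\<lambda>z. (cmod (?k z))\<^sup>2)"
    using bergman_normalized_kernel_bounded[OF assms]
    by (intro set_integrable_disk[of _ "((1 - (cmod l)\<^sup>2) / (1 - cmod l)\<^sup>2)\<^sup>2"] continuous_intros)
      (auto intro!: power_mono)
  then show ?thesis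
    using bergman_normalized_kernel_holomorphic[OF assms] by (simp add: bergman_space_def)
qed

lemma bergman_inner_kernel:
  assumes l: "cmod l < 1"
    and g: "continuous_on (ball 0 1) g" "\<And>z. cmod z < 1 \<Longrightarrow> cmod (g z) \<le> B"
  shows "(\<lambda>j. of_real (1 - (cmod l)\<^sup>2) * (of_nat (Suc j) * cnj l ^ j) * bergman_inner (\<lambda>z. z ^ j) g)
           sums bergman_inner (bergman_normalized_kernel l) g"
proof (rule bergman_inner_power_series[OF _ bergman_normalized_kernel_sums[OF l] g])
  have "summable (\<lambda>j. of_nat (Suc j) * cmod l ^ j)"
    using geometric_deriv_sums[of "cmod l"] l by (auto simp: sums_iff)
  from summable_mult[OF this, of "cmod (of_real (1 - (cmod l)\<^sup>2))"]
  show "summable (\<lambda>j. norm (of_real (1 - (cmod l)\<^sup>2) * (of_nat (Suc j) * cnj l ^ j)))"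
    by (simp only: norm_mult norm_power complex_mod_cnj norm_of_nat)
qed

lemma bergman_inner_kernel_monomial:
  assumes l: "cmod l < 1"
  shows "bergman_inner (bergman_normalized_kernel l) (\<lambda>z. z ^ n) = of_real (1 - (cmod l)\<^sup>2) * cnj l ^ n"
proof -
  have "(\<lambda>j. of_real (1 - (cmod l)\<^sup>2) * (of_nat (Suc j) * cnj l ^ j) * bergman_inner (\<lambda>z. z ^ j) (\<lambda>z. z ^ n))
           sums bergman_inner (bergman_normalized_kernel l) (\<lambda>z. z ^ n)"
    by (rule bergman_inner_kernel[OF l, of _ 1])
      (auto intro!: continuous_intros power_le_one simp: norm_power)
  \<comment> \<open>By orthogonality only \<open>j = n\<close> survives, and there the factor
    \<open>Suc j\<close> cancels the squared norm of the monomial.\<close>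
  also have "(\<lambda>j. of_real (1 - (cmod l)\<^sup>2) * (of_nat (Suc j) * cnj l ^ j) * bergman_inner (\<lambda>z. z ^ j) (\<lambda>z. z ^ n))
      = (\<lambda>j. if j = n then of_real (1 - (cmod l)\<^sup>2) * cnj l ^ j else 0)"
    by (auto simp: fun_eq_iff bergman_inner_monomials simp del: of_nat_Suc)
  finally show ?thesis
    by (rule sums_unique2) (rule sums_single[of n "\<lambda>j. of_real (1 - (cmod l)\<^sup>2) * cnj l ^ j"])
qed

lemma bergman_inner_monomial_kernel:
  assumes "cmod u < 1"
  shows "bergman_inner (\<lambda>z. z ^ n) (bergman_normalized_kernel u) = of_real (1 - (cmod u)\<^sup>2) * u ^ n"
  using bergman_inner_kernel_monomial[OF assms, of n]
    bergman_inner_commute[of "\<lambda>z. z ^ n" "bergman_normalized_kernel u"] by simp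

text \<open>Only the left kernel is expanded. Its terms paired with the right kernel form, up to the
  constant \<open>1 - (cmod u)^2\<close>, the power series of the left kernel at \<open>u\<close>;
  this is the reproducing property.\<close>

lemma bergman_inner_kernel_kernel:
  assumes l: "cmod l < 1" and u: "cmod u < 1"
  shows "bergman_inner (bergman_normalized_kernel l) (bergman_normalized_kernel u)
     = of_real ((1 - (cmod l)\<^sup>2) * (1 - (cmod u)\<^sup>2)) / (1 - cnj l * u)\<^sup>2"
proof -
  have "(\<lambda>j. of_real (1 - (cmod l)\<^sup>2) * (of_nat (Suc j) * cnj l ^ j)
          * bergman_inner (\<lambda>z. z ^ j) (bergman_normalized_kernel u))
      sums bergman_inner (bergman_normalized_kernel l) (bergman_normalized_kernel u)"
    using holomorphic_on_imp_continuous_on[OF bergman_normalized_kernel_holomorphic[OF u]]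
      bergman_normalized_kernel_bounded[OF u] by (rule bergman_inner_kernel[OF l])
  moreover have "(\<lambda>j. of_real (1 - (cmod l)\<^sup>2) * (of_nat (Suc j) * cnj l ^ j)
          * bergman_inner (\<lambda>z. z ^ j) (bergman_normalized_kernel u))
      sums (of_real (1 - (cmod u)\<^sup>2) * bergman_normalized_kernel l u)"
    using sums_mult[OF bergman_normalized_kernel_sums[OF l u], of "of_real (1 - (cmod u)\<^sup>2)"]
    by (simp add: bergman_inner_monomial_kernel[OF u] mult_ac)
  ultimately have "bergman_inner (bergman_normalized_kernel l) (bergman_normalized_kernel u)
      = of_real (1 - (cmod u)\<^sup>2) * bergman_normalized_kernel l u"
    by (rule sums_unique2)
  then show ?thesis by (simp add: bergman_normalized_kernel_def mult.commute)
qed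

section \<open>The radial profile of the range\<close>

text \<open>For \<open>s\<close> and \<open>r\<close> between -1 and 1 this is the solution
  \<open>t\<close> of \<open>(t - s) / (1 - s * t) = r\<close>: the point at signed pseudohyperbolic
  distance \<open>r\<close> from \<open>s\<close>, given by a Moebius map of the disk.\<close>

definition pseudohyperbolic_shift :: "real \<Rightarrow> real \<Rightarrow> real" where
  "pseudohyperbolic_shift r s = (s + r) / (1 + s * r)"

text \<open>
  The admissible pairs are \<open>l = s e\<close> and \<open>u = t e\<close> with \<open>|e| = 1\<close> and \<open>t\<close> the shift of
  the real number \<open>s\<close>; the profile is the element of the range that they give, up to the factor \<open>e ^ (m - n)\<close>.
\<close>
definition radial_profile :: "real \<Rightarrow> nat \<Rightarrow> nat \<Rightarrow> real \<Rightarrow> real" where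
  "radial_profile r n m s =
     (1 - s\<^sup>2) * (1 - (pseudohyperbolic_shift r s)\<^sup>2) * (s ^ n * pseudohyperbolic_shift r s ^ m)"

lemma one_plus_mult_pos:
  fixes r s :: real
  assumes "\<bar>r\<bar> < 1" "\<bar>s\<bar> \<le> 1"
  shows "1 + s * r > 0"
proof -
  have "\<bar>s * r\<bar> \<le> \<bar>r\<bar>"
    using assms mult_right_mono[of "\<bar>s\<bar>" 1 "\<bar>r\<bar>"] by (simp add: abs_mult)
  then show ?thesis using assms by linarith
qed

lemma one_minus_pseudohyperbolic_shift_square:
  assumes "1 + s * r \<noteq> 0"
  shows "1 - (pseudohyperbolic_shift r s)\<^sup>2 = (1 - s\<^sup>2) * (1 - r\<^sup>2) / (1 + s * r)\<^sup>2"
proof -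
  have "(1 + s * r)\<^sup>2 - (s + r)\<^sup>2 = (1 - s\<^sup>2) * (1 - r\<^sup>2)"
    by (simp add: power2_eq_square algebra_simps)
  then show ?thesis
    using assms by (simp add: pseudohyperbolic_shift_def power_divide diff_divide_eq_iff)
qed

lemma abs_pseudohyperbolic_shift_less_1:
  assumes "\<bar>r\<bar> < 1" "\<bar>s\<bar> < 1"
  shows "\<bar>pseudohyperbolic_shift r s\<bar> < 1"
proof -
  have "1 + s * r > 0" using assms by (intro one_plus_mult_pos) auto
  moreover have "s\<^sup>2 < 1" "r\<^sup>2 < 1" using assms by (simp_all add: abs_square_less_1)
  ultimately have "0 < 1 - (pseudohyperbolic_shift r s)\<^sup>2"
    by (subst one_minus_pseudohyperbolic_shift_square) auto
  then show ?thesis by (simp add: abs_square_less_1)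
qed

text \<open>With \<open>1 - r^2 = q\<close> this is the kernel constraint for a real pair, so every
  \<open>s\<close> in the open interval yields an admissible pair.\<close>

lemma pseudohyperbolic_shift_constraint:
  assumes "1 + s * r \<noteq> 0"
  shows "(1 - s\<^sup>2) * (1 - (pseudohyperbolic_shift r s)\<^sup>2)
           = (1 - r\<^sup>2) * (1 - s * pseudohyperbolic_shift r s)\<^sup>2"
proof -
  have "1 - s * pseudohyperbolic_shift r s = (1 - s\<^sup>2) / (1 + s * r)"
    using assms by (simp add: pseudohyperbolic_shift_def field_simps power2_eq_square)
  then show ?thesis
    by (simp add: one_minus_pseudohyperbolic_shift_square[OF assms] power_divide)
      (simp add: power2_eq_square)
qed

text \<open>The constraint is equivalent to \<open>(t - a)^2 = (r * (1 - a * t))^2\<close>. One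
  choice of sign makes \<open>t\<close> the shift of \<open>a\<close>; the other becomes the first
  when \<open>a\<close> and \<open>t\<close> are both negated.\<close>

lemma constraint_imp_pseudohyperbolic_shift:
  assumes r: "\<bar>r\<bar> < 1" and a: "\<bar>a\<bar> < 1"
    and eq: "(1 - a\<^sup>2) * (1 - t\<^sup>2) = (1 - r\<^sup>2) * (1 - a * t)\<^sup>2"
  shows "t = pseudohyperbolic_shift r a \<or> - t = pseudohyperbolic_shift r (- a)"
proof -
  have "(t - a)\<^sup>2 = (1 - a * t)\<^sup>2 - (1 - a\<^sup>2) * (1 - t\<^sup>2)"
    by (simp add: power2_eq_square algebra_simps)
  also have "\<dots> = (r * (1 - a * t))\<^sup>2"
    unfolding eq by (simp add: power2_eq_square algebra_simps)
  finally consider "t - a = r * (1 - a * t)" | "t - a = - (r * (1 - a * t))"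
    by (auto simp: power2_eq_iff)
  then show ?thesis
  proof cases
    case 1
    then have "t * (1 + a * r) = a + r" by (simp add: algebra_simps)
    moreover have "1 + a * r > 0" using r a by (intro one_plus_mult_pos) auto
    ultimately show ?thesis by (simp add: pseudohyperbolic_shift_def eq_divide_eq)
  next
    case 2
    then have "- t * (1 + (- a) * r) = - a + r" by (simp add: algebra_simps)
    moreover have "1 + (- a) * r > 0" using r a by (intro one_plus_mult_pos) auto
    ultimately show ?thesis by (simp add: pseudohyperbolic_shift_def eq_divide_eq)
  qed
qed

lemma radial_profile_range:
  assumes r: "0 < r" "r < 1" and n: "n \<ge> 1"
  obtains M where "M > 0" "\<And>s. \<bar>s\<bar> < 1 \<Longrightarrow> \<bar>radial_profile r n m s\<bar> \<le> M"
    "\<And>y. 0 \<le> y \<Longrightarrow> y \<le> M \<Longrightarrow> \<exists>s. \<bar>s\<bar> < 1 \<and> \<bar>radial_profile r n m s\<bar> = y"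
proof -
  let ?F = "\<lambda>s. \<bar>radial_profile r n m s\<bar>"
  have pos: "1 + s * r > 0" if "s \<in> {-1..1}" for s
    using that r by (intro one_plus_mult_pos) auto
  have cont: "continuous_on {-1..1} ?F"
    unfolding radial_profile_def pseudohyperbolic_shift_def
    using pos by (intro continuous_intros) force+
  obtain x where x: "x \<in> {-1..1}" and max: "\<And>s. s \<in> {-1..1} \<Longrightarrow> ?F s \<le> ?F x"
    using continuous_attains_sup[OF _ _ cont] by fastforce
  \<comment> \<open>Any \<open>s\<close> strictly between 0 and 1 would do: the profile is positive
    there, hence so is the maximum.\<close>
  have "pseudohyperbolic_shift r (1/2) > 0"
    using r by (simp add: pseudohyperbolic_shift_def)
  moreover have "1 - (pseudohyperbolic_shift r (1/2))\<^sup>2 > 0"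
    using abs_pseudohyperbolic_shift_less_1[of r "1/2"] r by (simp add: abs_square_less_1)
  ultimately have "?F (1/2) > 0"
    by (simp add: radial_profile_def power2_eq_square)
  then have pos': "?F x > 0" using max[of "1/2"] by simp
  show thesis
  proof (rule that[OF pos'])
    show "?F s \<le> ?F x" if "\<bar>s\<bar> < 1" for s using that by (intro max) auto
    fix y assume y: "0 \<le> y" "y \<le> ?F x"
    have F0: "?F 0 = 0" using n by (simp add: radial_profile_def)
    have conn: "connected (?F ` {-1..1})" by (intro connected_continuous_image cont) simp
    have "y \<in> ?F ` {-1..1}"
      using connectedD_interval[OF conn, of "?F 0" "?F x" y] x y F0 by auto
    then obtain s where s: "s \<in> {-1..1}" "?F s = y" by auto
    show "\<exists>s. \<bar>s\<bar> < 1 \<and> ?F s = y"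
    \<comment> \<open>The intermediate value may be attained at an end point, which must be
      excluded. The profile vanishes there, so only \<open>y = 0\<close> is affected, and
      \<open>s = 0\<close> serves for it because \<open>n\<close> is positive.\<close>
    proof (cases "y = 0")
      case True
      then show ?thesis using F0 by (intro exI[of _ 0]) simp
    next
      case False
      have "s\<^sup>2 \<noteq> 1"
      proof
        assume "s\<^sup>2 = 1"
        then have "?F s = 0" by (simp add: radial_profile_def)
        then show False using s False by simp
      qed
      then have "\<bar>s\<bar> < 1" using s(1) by (auto simp: power2_eq_1_iff abs_less_iff less_le)
      then show ?thesis using s by auto
    qed
  qed
qed

section \<open>The constraint and the range in explicit form\<close>

lemma kernel_constraint_real:
  assumes l: "cmod l < 1" and u: "cmod u < 1" and "0 < q"
    and eq: "of_real ((1 - (cmod l)\<^sup>2) * (1 - (cmod u)\<^sup>2)) / (1 - cnj l * u)\<^sup>2 = complex_of_real q"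
  shows "cnj l * u \<in> \<real>"
    and "(1 - (cmod l)\<^sup>2) * (1 - (cmod u)\<^sup>2) = q * (1 - Re (cnj l * u))\<^sup>2"
proof -
  define v where "v = 1 - cnj l * u"
  have v0: "v \<noteq> 0" unfolding v_def by (rule one_minus_cnj_mult_nonzero[OF l u])
  have "cmod (cnj l * u) < 1"
    using l u mult_strict_mono'[of "cmod l" 1 "cmod u" 1] by (simp add: norm_mult)
  then have Re: "Re v > 0"
    using complex_Re_le_cmod[of "cnj l * u"] by (simp add: v_def)
  have eq': "of_real ((1 - (cmod l)\<^sup>2) * (1 - (cmod u)\<^sup>2)) = complex_of_real q * v\<^sup>2"
    using eq v0 by (simp only: v_def[symmetric] divide_eq_eq) simp
  \<comment> \<open>This imaginary part is \<open>2 * q * Re v * Im v\<close> with \<open>q\<close>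
    and \<open>Re v\<close> positive, so \<open>Im v\<close> must vanish.\<close>
  then have "Im (complex_of_real q * v\<^sup>2) = 0" by (metis Im_complex_of_real)
  then have "Im v = 0" using Re \<open>0 < q\<close> by (simp add: power2_eq_square)
  then show "cnj l * u \<in> \<real>" by (simp add: v_def complex_is_Real_iff)
  have "v = of_real (1 - Re (cnj l * u))"
    using \<open>Im v = 0\<close> by (simp add: v_def complex_eq_iff)
  then show "(1 - (cmod l)\<^sup>2) * (1 - (cmod u)\<^sup>2) = q * (1 - Re (cnj l * u))\<^sup>2"
    using eq' by (simp only: of_real_power[symmetric] of_real_mult[symmetric] of_real_eq_iff)
qed

lemma exists_unit_root:
  assumes "cmod w = 1" "d > 0"
  obtains e where "cmod e = 1" "e ^ d = w"
proof
  show "cmod (cis (Arg w / d)) = 1" by simp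
  have "cis (Arg w / d) ^ d = cis (real d * (Arg w / d))" by (rule Complex.DeMoivre)
  also have "\<dots> = w" using assms rcis_cmod_Arg[of w] by (simp add: rcis_def)
  finally show "cis (Arg w / d) ^ d = w" .
qed

lemma q_berezin_range_rank_one:
  assumes T: "\<forall>f\<in>bergman_space. \<forall>z\<in>ball 0 1. T f z = bergman_inner f (\<lambda>w. w ^ n) * z ^ m"
  shows "q_berezin_range q T =
    {of_real ((1 - (cmod l)\<^sup>2) * (1 - (cmod u)\<^sup>2)) * (cnj l ^ n * u ^ m) | l u.
       cmod l < 1 \<and> cmod u < 1 \<and>
       of_real ((1 - (cmod l)\<^sup>2) * (1 - (cmod u)\<^sup>2)) / (1 - cnj l * u)\<^sup>2 = q}"
proof -
  have *: "bergman_inner (T (bergman_normalized_kernel l)) (bergman_normalized_kernel u)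
      = of_real ((1 - (cmod l)\<^sup>2) * (1 - (cmod u)\<^sup>2)) * (cnj l ^ n * u ^ m)"
    if l: "cmod l < 1" and u: "cmod u < 1" for l u
  proof -
    let ?k = "bergman_normalized_kernel"
    have "bergman_inner (T (?k l)) (?k u) = bergman_inner (\<lambda>z. bergman_inner (?k l) (\<lambda>w. w ^ n) * z ^ m) (?k u)"
      \<comment> \<open>\<open>T\<close> is prescribed only on the Bergman space and only inside the
        disk; the kernel lies in that space, and the inner product sees no other points.\<close>
      using T bergman_normalized_kernel_in_space[OF l] by (intro bergman_inner_cong) auto
    also have "\<dots> = bergman_inner (?k l) (\<lambda>w. w ^ n) * bergman_inner (\<lambda>z. z ^ m) (?k u)"
      by (rule bergman_inner_mult_left)
    finally show ?thesis
      by (simp add: bergman_inner_kernel_monomial[OF l] bergman_inner_monomial_kernel[OF u] mult_ac)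
  qed
  show ?thesis
    unfolding q_berezin_range_def
    by (intro Collect_cong ex_cong1) (auto simp only: mem_ball_0 * bergman_inner_kernel_kernel)
qed

theorem theorem3p5:
  fixes q :: real and m n :: nat
    and T :: "(complex \<Rightarrow> complex) \<Rightarrow> complex \<Rightarrow> complex"
  assumes "0 < q" and "q < 1"
    and "1 \<le> n" and "n < m"
    and "\<And>f z. f \<in> bergman_space \<Longrightarrow> z \<in> ball 0 1 \<Longrightarrow>
           T f z = bergman_inner f (\<lambda>w. w ^ n) * z ^ m"
  shows "\<exists>r>0. q_berezin_range (complex_of_real q) T = ball 0 r \<or>
               q_berezin_range (complex_of_real q) T = cball 0 r"
proof -
  \<comment> \<open>The constraint puts \<open>l\<close> and \<open>u\<close> at pseudohyperbolic
    distance \<open>r\<close>, by the identity \<open>1 - r^2 = q\<close>.\<close>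
  define r where "r = sqrt (1 - q)"
  have r: "0 < r" "r < 1" and r2: "1 - r\<^sup>2 = q" using assms(1,2) by (auto simp: r_def)
  obtain M where M: "M > 0"
    and le: "\<And>s. \<bar>s\<bar> < 1 \<Longrightarrow> \<bar>radial_profile r n m s\<bar> \<le> M"
    and ex: "\<And>y. 0 \<le> y \<Longrightarrow> y \<le> M \<Longrightarrow> \<exists>s. \<bar>s\<bar> < 1 \<and> \<bar>radial_profile r n m s\<bar> = y"
    using radial_profile_range[OF r assms(3)] by metis
  have "\<forall>f\<in>bergman_space. \<forall>z\<in>ball 0 1. T f z = bergman_inner f (\<lambda>w. w ^ n) * z ^ m"
    using assms(5) by blast
  note range = q_berezin_range_rank_one[OF this]
  have "q_berezin_range (complex_of_real q) T = cball 0 M"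
  proof (intro set_eqI iffI)
    fix w assume "w \<in> q_berezin_range (complex_of_real q) T"
    then obtain l u where w: "w = of_real ((1 - (cmod l)\<^sup>2) * (1 - (cmod u)\<^sup>2)) * (cnj l ^ n * u ^ m)"
      and l: "cmod l < 1" and u: "cmod u < 1"
      and eq: "of_real ((1 - (cmod l)\<^sup>2) * (1 - (cmod u)\<^sup>2)) / (1 - cnj l * u)\<^sup>2 = complex_of_real q"
      unfolding range by auto
    note con = kernel_constraint_real[OF l u assms(1) eq]
    have "\<bar>Re (cnj l * u)\<bar> = cmod l * cmod u"
      using con(1) by (metis complex_mod_cnj in_Reals_norm norm_mult)
    \<comment> \<open>\<open>t\<close> is the modulus of \<open>u\<close> with the sign of the real
      number \<open>cnj l * u\<close>, as if \<open>l\<close> had been rotated onto the nonnegative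
      real axis.\<close>
    then obtain t where t: "\<bar>t\<bar> = cmod u" "Re (cnj l * u) = cmod l * t"
      by (metis abs_minus_cancel abs_norm_cancel abs_if minus_mult_right minus_minus)
    have t2: "(cmod u)\<^sup>2 = t\<^sup>2" by (simp flip: t(1))
    have "(1 - (cmod l)\<^sup>2) * (1 - t\<^sup>2) = (1 - r\<^sup>2) * (1 - cmod l * t)\<^sup>2"
      using con(2) unfolding t2 t(2) r2 .
    then have "t = pseudohyperbolic_shift r (cmod l) \<or> - t = pseudohyperbolic_shift r (- cmod l)"
      using r l by (intro constraint_imp_pseudohyperbolic_shift) auto
    \<comment> \<open>\<open>s\<close> is \<open>cmod l\<close> or its negative, according to the
      sign case. Only moduli matter below, so the two cases merge.\<close>
    then obtain s where s: "\<bar>s\<bar> = cmod l" "\<bar>pseudohyperbolic_shift r s\<bar> = cmod u"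
      using t(1) by (metis abs_minus_cancel abs_norm_cancel)
    have "cmod w = \<bar>radial_profile r n m s\<bar>"
      by (simp only: w norm_mult norm_power norm_of_real complex_mod_cnj radial_profile_def
          abs_mult power_abs power2_abs flip: s)
    then show "w \<in> cball 0 M" using le[of s] s l by simp
  next
    fix w :: complex assume "w \<in> cball 0 M"
    then obtain s where s: "\<bar>s\<bar> < 1" "\<bar>radial_profile r n m s\<bar> = cmod w"
      using ex[of "cmod w"] by auto
    define P where "P = radial_profile r n m s"
    define t where "t = pseudohyperbolic_shift r s"
    \<comment> \<open>The phase that turns the real number \<open>P\<close> into \<open>w\<close>.
      If \<open>P = 0\<close> then \<open>w = 0\<close>, and any unimodular value works.\<close>
    define \<xi> where "\<xi> = (if P = 0 then 1 else w / of_real P)"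
    have P: "\<bar>P\<bar> = cmod w" using s(2) by (simp add: P_def)
    then have "cmod \<xi> = 1" "w = \<xi> * of_real P" by (auto simp: \<xi>_def norm_divide)
    \<comment> \<open>The root exists because \<open>m - n\<close> is positive. Rotating both points
      by \<open>e\<close> multiplies the value by \<open>cnj e ^ n * e ^ m\<close>, which is
      \<open>e ^ (m - n)\<close>, and leaves \<open>cnj l * u\<close> and hence the constraint
      unchanged.\<close>
    then obtain e where e: "cmod e = 1" "e ^ (m - n) = \<xi>"
      using exists_unit_root[of \<xi> "m - n"] assms(4) by auto
    have ee: "cnj e * e = 1" using e(1) complex_norm_square[of e] by (simp add: mult.commute)
    have "cnj e ^ n * e ^ m = (cnj e * e) ^ n * e ^ (m - n)"
      using assms(4) by (simp add: power_mult_distrib mult.assoc flip: power_add)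
    then have em: "cnj e ^ n * e ^ m = \<xi>" by (simp add: ee e(2))
    define l where "l = of_real s * e"
    define u where "u = of_real t * e"
    have nl: "cmod l = \<bar>s\<bar>" and nu: "cmod u = \<bar>t\<bar>" by (simp_all add: l_def u_def norm_mult e(1))
    have t1: "\<bar>t\<bar> < 1"
      unfolding t_def using r s by (intro abs_pseudohyperbolic_shift_less_1) auto
    have lu: "cnj l * u = of_real (s * t)"
      using ee by (simp add: l_def u_def mult_ac)
    have nz: "1 - cnj l * u \<noteq> 0"
      using s t1 by (intro one_minus_cnj_mult_nonzero) (auto simp: nl nu)
    have "1 + s * r \<noteq> 0" using one_plus_mult_pos[of r s] r s by auto
    then have "(1 - s\<^sup>2) * (1 - t\<^sup>2) = q * (1 - s * t)\<^sup>2"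
      unfolding t_def r2[symmetric] by (rule pseudohyperbolic_shift_constraint)
    then have "of_real ((1 - (cmod l)\<^sup>2) * (1 - (cmod u)\<^sup>2)) = of_real q * (1 - cnj l * u)\<^sup>2"
      by (simp only: nl nu lu power2_abs of_real_mult of_real_power of_real_diff of_real_1)
    then have "of_real ((1 - (cmod l)\<^sup>2) * (1 - (cmod u)\<^sup>2)) / (1 - cnj l * u)\<^sup>2 = complex_of_real q"
      using nz by (simp only: divide_eq_eq) simp
    moreover have "w = of_real ((1 - (cmod l)\<^sup>2) * (1 - (cmod u)\<^sup>2)) * (cnj l ^ n * u ^ m)"
    proof -
      have "cnj l ^ n * u ^ m = of_real (s ^ n * t ^ m) * (cnj e ^ n * e ^ m)"
        by (simp add: l_def u_def power_mult_distrib mult_ac)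
      then have "of_real ((1 - (cmod l)\<^sup>2) * (1 - (cmod u)\<^sup>2)) * (cnj l ^ n * u ^ m) = of_real P * \<xi>"
        by (simp add: em nl nu P_def radial_profile_def t_def)
      then show ?thesis using \<open>w = \<xi> * of_real P\<close> by (simp add: mult.commute)
    qed
    moreover have "cmod l < 1" "cmod u < 1" using s t1 nl nu by auto
    ultimately show "w \<in> q_berezin_range (complex_of_real q) T"
      unfolding range by blast
  qed
  then show ?thesis using M by blast
qed

end
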